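(* Let $n \ge 1$ and let $h_1, \ldots, h_n > 0$ satisfy $\sum_{i=1}^n h_i \le 1$. (a) In the fixed-rate cup game on $n$ cups with fill rates $h_1,\dots,h_n$, the Deadline-Driven Strategy keeps the height of every cup strictly less than $2$ at all times. (b) In the bamboo trimming problem on $n$ bamboo with growth rates $h_1,\dots,h_n$, the analogous Deadline-Driven Strategy (which cuts the chosen bamboo to height $0$) keeps the height of every bamboo strictly less than $2$ at all times.
   Context: Fixed-rate cup game: cups $b_1,\dots,b_n$ start empty; at the beginning of each time step each cup $b_i$ receives $h_i$ units of water, after which the player selects one cup and removes $1$ unit of water from it (emptying it if it contains less than $1$ unit), or does nothing. Bamboo trimming problem: identical, except that the selected bamboo is cut to height $0$. Heights are considered at all times, including right after water is added and before removal. Deadline-Driven Strategy: in each step, after filling, consider the cups (bamboo) of current height at least $1$; if there are none, do nothing; otherwise act on one that, absent any removal, would soonest reach height $2$ (i.e., minimizing the number of further fill steps needed to reach height $\ge 2$), ties broken arbitrarily. *)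

theory Defs
  imports Complex_Main
begin

text \<open>
  Cups (bamboo) are indexed by \<open>{1..n}\<close>. A play is a pair \<open>(w, a)\<close>: \<open>w t i\<close> is the height of
  \<open>i\<close> at the beginning of time step \<open>t\<close> (\<open>t = 0, 1, \<dots>\<close>), i.e. after the removal of the
  previous step, and \<open>a t\<close> is the player's action in step \<open>t\<close> (\<open>None\<close> for doing nothing).
\<close>

definition fill :: "(nat \<Rightarrow> real) \<Rightarrow> (nat \<Rightarrow> real) \<Rightarrow> nat \<Rightarrow> real" where
  "fill h x = (\<lambda>i. x i + h i)"

definition remove_unit :: "real \<Rightarrow> real" where
  "remove_unit y = (if y < 1 then 0 else y - 1)"

definition cut :: "real \<Rightarrow> real" where
  "cut y = 0"

fun act :: "(real \<Rightarrow> real) \<Rightarrow> (nat \<Rightarrow> real) \<Rightarrow> nat option \<Rightarrow> nat \<Rightarrow> real" where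
  "act r y None = y"
| "act r y (Some i) = y(i := r (y i))"

definition play ::
  "(real \<Rightarrow> real) \<Rightarrow> nat \<Rightarrow> (nat \<Rightarrow> real) \<Rightarrow> (nat \<Rightarrow> nat \<Rightarrow> real) \<Rightarrow> (nat \<Rightarrow> nat option) \<Rightarrow> bool" where
  "play r n h w a \<longleftrightarrow>
     (\<forall>i\<in>{1..n}. w 0 i = 0) \<and>
     (\<forall>t. set_option (a t) \<subseteq> {1..n}) \<and>
     (\<forall>t. \<forall>i\<in>{1..n}. w (Suc t) i = act r (fill h (w t)) (a t) i)"

definition cup_game_play ::
  "nat \<Rightarrow> (nat \<Rightarrow> real) \<Rightarrow> (nat \<Rightarrow> nat \<Rightarrow> real) \<Rightarrow> (nat \<Rightarrow> nat option) \<Rightarrow> bool" where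
  "cup_game_play = play remove_unit"

definition bamboo_play ::
  "nat \<Rightarrow> (nat \<Rightarrow> real) \<Rightarrow> (nat \<Rightarrow> nat \<Rightarrow> real) \<Rightarrow> (nat \<Rightarrow> nat option) \<Rightarrow> bool" where
  "bamboo_play = play cut"

text \<open>
  The argument \<open>y\<close> below is a vector of heights after filling and before removal. The \<open>LEAST\<close>
  exists whenever \<open>h i > 0\<close>, and it is \<open>0\<close> if the height is already at least \<open>2\<close>.
\<close>

definition steps_to_two :: "(nat \<Rightarrow> real) \<Rightarrow> (nat \<Rightarrow> real) \<Rightarrow> nat \<Rightarrow> nat" where
  "steps_to_two h y i = (LEAST k::nat. y i + real k * h i \<ge> 2)"

definition deadline_driven_choice ::
  "nat \<Rightarrow> (nat \<Rightarrow> real) \<Rightarrow> (nat \<Rightarrow> real) \<Rightarrow> nat option \<Rightarrow> bool" where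
  "deadline_driven_choice n h y c \<longleftrightarrow>
     (case c of
        None \<Rightarrow> \<forall>j\<in>{1..n}. y j < 1
      | Some i \<Rightarrow> i \<in> {1..n} \<and> y i \<ge> 1 \<and>
          (\<forall>j\<in>{1..n}. y j \<ge> 1 \<longrightarrow> steps_to_two h y i \<le> steps_to_two h y j))"

text \<open>
  Ties may be broken in any way, even depending on the history, so following the strategy is a
  property of a play rather than a function of the heights.
\<close>

definition follows_deadline_driven ::
  "nat \<Rightarrow> (nat \<Rightarrow> real) \<Rightarrow> (nat \<Rightarrow> nat \<Rightarrow> real) \<Rightarrow> (nat \<Rightarrow> nat option) \<Rightarrow> bool" where
  "follows_deadline_driven n h w a \<longleftrightarrow>
     (\<forall>t. deadline_driven_choice n h (fill h (w t)) (a t))"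

text \<open>Both the heights between steps and those right after filling count.\<close>

definition heights_always_below ::
  "real \<Rightarrow> nat \<Rightarrow> (nat \<Rightarrow> real) \<Rightarrow> (nat \<Rightarrow> nat \<Rightarrow> real) \<Rightarrow> bool" where
  "heights_always_below B n h w \<longleftrightarrow>
     (\<forall>t. \<forall>i\<in>{1..n}. w t i < B \<and> fill h (w t) i < B)"

end

(* Suppose the cup i reaches height 2 after the filling of step T. Call a step t < T urgent if
   it acts on a cup that would reach height 2 by step T without the action, and let s be minimal
   such that all of the steps s, ..., T - 1 are urgent. Step s - 1 is not urgent, so by the
   deadline rule each cup starts step s at height below 1 or is not due by step T even without
   any removal. A cup of the latter kind receives no action in s, ..., T - 1. A cup of the former
   kind with N > 0 actions there has projected height at least N + 1 at T, since every action
   removes at least 1 and just before the last one the projection is still at least 2; so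
   N < (T + 1 - s) h. For i itself even N + 1 < (T + 1 - s) h. Summing over all cups gives
   T - s + 1 < (T + 1 - s) sum h, a contradiction. Of the removal rule r this uses only
   r y <= y - 1 for y >= 1, so it covers both games. *)
theory Submission
  imports Defs
begin

text \<open>Since the rate is positive, some number of fillings suffices and the
  \<open>LEAST\<close> is attained. Comparing deadlines thus reduces to linear inequalities at a
  fixed horizon \<open>k\<close>.\<close>

lemma steps_to_two_le_iff:
  assumes "h i > 0"
  shows "steps_to_two h y i \<le> k \<longleftrightarrow> 2 \<le> y i + real k * h i"
proof
  assume le: "steps_to_two h y i \<le> k"
  obtain m where "2 - y i < real m * h i"
    using reals_Archimedean3[OF assms] by blast
  then have "2 \<le> y i + real m * h i"
    by simp
  then have "2 \<le> y i + real (steps_to_two h y i) * h i"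
    unfolding steps_to_two_def by (rule LeastI)
  also have "\<dots> \<le> y i + real k * h i"
    using le assms by simp
  finally show "2 \<le> y i + real k * h i" .
next
  assume "2 \<le> y i + real k * h i"
  then show "steps_to_two h y i \<le> k"
    unfolding steps_to_two_def by (rule Least_le)
qed

lemma exists_maximal_final_run:
  fixes T :: nat
  obtains s where "s \<le> T" "\<And>t. s \<le> t \<Longrightarrow> t < T \<Longrightarrow> P t" "s = 0 \<or> \<not> P (s - 1)"
proof -
  define Q where "Q s \<longleftrightarrow> s \<le> T \<and> (\<forall>t. s \<le> t \<and> t < T \<longrightarrow> P t)" for s
  have "Q T"
    by (auto simp: Q_def)
  then obtain s where s: "Q s" and least: "\<And>m. m < s \<Longrightarrow> \<not> Q m"
    using exists_least_iff[of Q] by blast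
  have "s = 0 \<or> \<not> P (s - 1)"
  proof (cases s)
    case (Suc m)
    have "\<not> P m"
    proof
      assume "P m"
      then have "P t" if "m \<le> t" "t < T" for t
        using s Suc that by (cases "t = m") (simp_all add: Q_def)
      then have "Q m"
        using s Suc by (simp add: Q_def)
      then show False
        using least Suc by simp
    qed
    then show ?thesis
      using Suc by simp
  qed simp
  then show thesis
    using that s unfolding Q_def by blast
qed

text \<open>The fillings of steps \<open>t, \<dots>, T\<close> all count, hence \<open>Suc T - t\<close>; meaningful for \<open>t \<le> Suc T\<close>.\<close>

definition projection :: "(nat \<Rightarrow> real) \<Rightarrow> (nat \<Rightarrow> nat \<Rightarrow> real) \<Rightarrow> nat \<Rightarrow> nat \<Rightarrow> nat \<Rightarrow> real" where
  "projection h w T t i = w t i + real (Suc T - t) * h i"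

definition urgent ::
  "(nat \<Rightarrow> real) \<Rightarrow> (nat \<Rightarrow> nat \<Rightarrow> real) \<Rightarrow> (nat \<Rightarrow> nat option) \<Rightarrow> nat \<Rightarrow> nat \<Rightarrow> bool" where
  "urgent h w a T t \<longleftrightarrow> (\<exists>i. a t = Some i \<and> 2 \<le> projection h w T t i)"

definition num_actions :: "(nat \<Rightarrow> nat option) \<Rightarrow> nat \<Rightarrow> nat \<Rightarrow> nat \<Rightarrow> nat" where
  "num_actions a T s i = card {t \<in> {s..<T}. a t = Some i}"

lemma num_actions_self [simp]: "num_actions a T T i = 0"
  by (simp add: num_actions_def)

lemma num_actions_step:
  assumes "s < T"
  shows "num_actions a T s i = num_actions a T (Suc s) i + of_bool (a s = Some i)"
proof -
  have "{t \<in> {s..<T}. a t = Some i} =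
      {t \<in> {Suc s..<T}. a t = Some i} \<union> (if a s = Some i then {s} else {})"
    using assms by (auto simp: Suc_le_eq order_le_less)
  then show ?thesis
    by (simp add: num_actions_def)
qed

lemma sum_num_actions:
  assumes "finite A" "\<And>t. s \<le> t \<Longrightarrow> t < T \<Longrightarrow> \<exists>i\<in>A. a t = Some i"
  shows "(\<Sum>i\<in>A. num_actions a T s i) = T - s"
proof -
  have "{s..<T} = (\<Union>i\<in>A. {t \<in> {s..<T}. a t = Some i})"
    using assms(2) by fastforce
  then have "T - s = card (\<Union>i\<in>A. {t \<in> {s..<T}. a t = Some i})"
    by (metis card_atLeastLessThan)
  also have "\<dots> = (\<Sum>i\<in>A. num_actions a T s i)"
    unfolding num_actions_def using assms(1) by (intro card_UN_disjoint) auto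
  finally show ?thesis ..
qed

locale deadline_driven_play =
  fixes r :: "real \<Rightarrow> real" and n :: nat and h :: "nat \<Rightarrow> real"
    and w :: "nat \<Rightarrow> nat \<Rightarrow> real" and a :: "nat \<Rightarrow> nat option"
  assumes removes_unit: "\<And>y. 1 \<le> y \<Longrightarrow> r y \<le> y - 1"
    and rates_pos: "\<And>i. i \<in> {1..n} \<Longrightarrow> 0 < h i"
    and rates_sum: "(\<Sum>i = 1..n. h i) \<le> 1"
    and play: "play r n h w a"
    and follows: "follows_deadline_driven n h w a"
begin

lemma choice: "deadline_driven_choice n h (fill h (w t)) (a t)"
  using follows by (simp add: follows_deadline_driven_def)

lemma acted_on:
  assumes "a t = Some i"
  shows "i \<in> {1..n}" "1 \<le> fill h (w t) i"
  using choice[of t] assms by (auto simp: deadline_driven_choice_def)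

lemma low_if_no_action:
  assumes "a t = None" "i \<in> {1..n}"
  shows "fill h (w t) i < 1"
  using choice[of t] assms by (auto simp: deadline_driven_choice_def)

lemma height_other:
  assumes "i \<in> {1..n}" "a t \<noteq> Some i"
  shows "w (Suc t) i = w t i + h i"
  using play assms by (cases "a t") (auto simp: play_def fill_def)

lemma height_acted_on:
  assumes "a t = Some i"
  shows "w (Suc t) i \<le> w t i + h i - 1"
  using play acted_on[OF assms] removes_unit[of "fill h (w t) i"] assms
  by (auto simp: play_def fill_def)

text \<open>A filling moves from the part still to come into the height, so only an action changes
  the projection. The strategy acts only on heights at least 1, where \<open>r\<close> removes at
  least 1.\<close>

lemma projection_step:
  assumes "i \<in> {1..n}" "t < T"
  shows "projection h w T (Suc t) i \<le> projection h w T t i - of_bool (a t = Some i)"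
proof -
  have "real (Suc T - t) = real (Suc T - Suc t) + 1"
    using assms(2) by simp
  then show ?thesis
    using height_other[OF assms(1), of t] height_acted_on[of t i]
    by (cases "a t = Some i") (auto simp: projection_def distrib_right)
qed

lemma num_actions_le_projection:
  assumes i: "i \<in> {1..n}" and "s \<le> T"
    and "\<And>t. s \<le> t \<Longrightarrow> t < T \<Longrightarrow> urgent h w a T t"
    and "0 < num_actions a T s i"
  shows "real (num_actions a T s i) + 1 \<le> projection h w T s i"
  using assms(2-)
proof (induction s rule: inc_induct)
  case base
  then show ?case
    by simp
next
  case (step s)
  show ?case
  proof (cases "num_actions a T (Suc s) i = 0")
    case True
    \<comment> \<open>Step \<open>s\<close> is the last action on \<open>i\<close> before
      \<open>T\<close>, and its urgency supplies the bound 2.\<close>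
    then have "a s = Some i" "num_actions a T s i = 1"
      using step.prems(2) num_actions_step[OF step.hyps(2), of a i] by (auto split: if_splits)
    then show ?thesis
      using step.prems(1)[of s] step.hyps by (auto simp: urgent_def)
  next
    case False
    then have "real (num_actions a T (Suc s) i) + 1 \<le> projection h w T (Suc s) i"
      using step.IH step.prems(1) by simp
    then show ?thesis
      using projection_step[OF i step.hyps(2)] num_actions_step[OF step.hyps(2), of a i]
      by simp
  qed
qed

text \<open>No urgency is assumed here. For the cup that reaches 2 at \<open>T\<close> the final
  projection is at least 2, which gains one unit over the bound obtained from urgency.\<close>

lemma projection_lower_bound:
  assumes "i \<in> {1..n}" "s \<le> T"
  shows "projection h w T T i + real (num_actions a T s i) \<le> projection h w T s i"
  using assms(2)
proof (induction s rule: inc_induct)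
  case base
  then show ?case
    by simp
next
  case (step s)
  then show ?case
    using projection_step[OF assms(1) step.hyps(2)] num_actions_step[OF step.hyps(2), of a i]
    by simp
qed

text \<open>If \<open>i\<close> has height at least 1 after filling, the chosen cup is due no later
  than \<open>i\<close>, yet not by \<open>T\<close>. If \<open>i\<close> is below 1, it is left
  alone and stays below 1.\<close>

lemma low_or_not_due_after_non_urgent:
  assumes i: "i \<in> {1..n}" and "t < T" and "\<not> urgent h w a T t"
  shows "w (Suc t) i < 1 \<or> projection h w T (Suc t) i < 2"
proof -
  have proj: "projection h w T t j = fill h (w t) j + real (T - t) * h j" for j
    using assms(2) by (simp add: projection_def fill_def Suc_diff_le algebra_simps)
  show ?thesis
  proof (cases "1 \<le> fill h (w t) i")
    case True
    then have "a t \<noteq> None"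
      using low_if_no_action[OF _ i] by force
    then obtain c where c: "a t = Some c" "c \<in> {1..n}"
      and least: "steps_to_two h (fill h (w t)) c \<le> steps_to_two h (fill h (w t)) i"
      using choice[of t] i True by (auto simp: deadline_driven_choice_def)
    \<comment> \<open>After the filling of step \<open>t\<close>, exactly \<open>T - t\<close>
      fillings remain up to and including that of step \<open>T\<close>.\<close>
    have "\<not> steps_to_two h (fill h (w t)) c \<le> T - t"
      using assms(3) c(1) steps_to_two_le_iff[of h c, OF rates_pos[OF c(2)]]
      by (auto simp: urgent_def proj)
    then have "\<not> steps_to_two h (fill h (w t)) i \<le> T - t"
      using least by simp
    then have "projection h w T t i < 2"
      using steps_to_two_le_iff[of h i, OF rates_pos[OF i]] by (simp add: proj)
    then show ?thesis
      using projection_step[OF i assms(2)] by (auto simp: of_bool_def split: if_splits)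
  next
    case False
    then have "a t \<noteq> Some i"
      using acted_on(2) by blast
    then show ?thesis
      using height_other[OF i] False by (simp add: fill_def)
  qed
qed

lemma fill_less_two:
  assumes i: "i \<in> {1..n}"
  shows "fill h (w T) i < 2"
proof (rule ccontr)
  assume "\<not> fill h (w T) i < 2"
  then have due: "2 \<le> projection h w T T i"
    by (simp add: projection_def fill_def)
  obtain s where s: "s \<le> T" "\<And>t. s \<le> t \<Longrightarrow> t < T \<Longrightarrow> urgent h w a T t"
    and start: "s = 0 \<or> \<not> urgent h w a T (s - 1)"
    using exists_maximal_final_run[of T "urgent h w a T"] by blast
  define L where "L = real (Suc T - s)"
  have low: "w s j < 1 \<or> projection h w T s j < 2" if "j \<in> {1..n}" for j
  proof (cases s)
    case 0
    then show ?thesis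
      using play that by (auto simp: play_def)
  next
    case (Suc t)
    then show ?thesis
      using low_or_not_due_after_non_urgent[OF that, of t T] s(1) start by simp
  qed
  have le: "real (num_actions a T s j) \<le> L * h j" if j: "j \<in> {1..n}" for j
  proof (cases "num_actions a T s j = 0")
    case True
    then show ?thesis
      using rates_pos[OF j] by (simp add: L_def)
  next
    case False
    then have "real (num_actions a T s j) + 1 \<le> projection h w T s j"
      using num_actions_le_projection[OF j s] by simp
    \<comment> \<open>One action already forces the projection at \<open>s\<close> to be at least 2,
      so \<open>low\<close> leaves \<open>w s j < 1\<close>.\<close>
    then show ?thesis
      using low[OF j] False unfolding projection_def L_def by linarith
  qed
  \<comment> \<open>By \<open>due\<close> the projection at \<open>s\<close> is at least 2 even if
    \<open>i\<close> receives no action, so again \<open>w s i < 1\<close>.\<close>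
  have less: "real (num_actions a T s i) + 1 < L * h i"
    using projection_lower_bound[OF i s(1)] due low[OF i] unfolding projection_def L_def by linarith
  have "(\<Sum>j = 1..n. num_actions a T s j) = T - s"
    using s(2) acted_on(1) unfolding urgent_def by (intro sum_num_actions) blast+
  then have "L = (\<Sum>j = 1..n. real (num_actions a T s j)) + 1"
    using s(1) by (simp add: L_def Suc_diff_le flip: of_nat_sum)
  \<comment> \<open>The extra 1 in \<open>L\<close>, from the filling of step \<open>T\<close>, is
    charged to cup \<open>i\<close>, where \<open>less\<close> has room for it.\<close>
  also have "\<dots> = (\<Sum>j = 1..n. real (num_actions a T s j) + of_bool (j = i))"
    using i by (simp add: sum.distrib of_bool_def)
  also have "\<dots> < (\<Sum>j = 1..n. L * h j)"
  proof (rule sum_strict_mono_ex1)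
    show "\<forall>j\<in>{1..n}. real (num_actions a T s j) + of_bool (j = i) \<le> L * h j"
      using le less by (auto simp: less_imp_le)
    show "\<exists>j\<in>{1..n}. real (num_actions a T s j) + of_bool (j = i) < L * h j"
      using i less by (intro bexI[of _ i]) auto
  qed simp
  also have "\<dots> \<le> L"
    using mult_left_mono[OF rates_sum, of L] by (simp add: L_def sum_distrib_left)
  finally show False
    by simp
qed

lemma heights_always_below_two: "heights_always_below 2 n h w"
  unfolding heights_always_below_def
proof (intro allI ballI conjI)
  fix t i
  assume i: "i \<in> {1..n}"
  show "fill h (w t) i < 2"
    by (rule fill_less_two[OF i])
  then show "w t i < 2"
    using rates_pos[OF i] by (simp add: fill_def)
qed

end

theorem theorem4p1:
  fixes n :: nat and h :: "nat \<Rightarrow> real"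
  assumes "n \<ge> 1"
    and "\<And>i. i \<in> {1..n} \<Longrightarrow> h i > 0"
    and "(\<Sum>i = 1..n. h i) \<le> 1"
  shows "(\<forall>w a. cup_game_play n h w a \<and> follows_deadline_driven n h w a \<longrightarrow>
            heights_always_below 2 n h w) \<and>
         (\<forall>w a. bamboo_play n h w a \<and> follows_deadline_driven n h w a \<longrightarrow>
            heights_always_below 2 n h w)"
proof (intro conjI allI impI; elim conjE)
  fix w a
  assume "cup_game_play n h w a" "follows_deadline_driven n h w a"
  then interpret deadline_driven_play remove_unit n h w a
    using assms by unfold_locales (auto simp: cup_game_play_def remove_unit_def)
  show "heights_always_below 2 n h w"
    by (rule heights_always_below_two)
next
  fix w a
  assume "bamboo_play n h w a" "follows_deadline_driven n h w a"
  then interpret deadline_driven_play cut n h w a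
    using assms by unfold_locales (auto simp: bamboo_play_def cut_def)
  show "heights_always_below 2 n h w"
    by (rule heights_always_below_two)
qed

end
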